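(* Let $\{S_j\}_{j=1}^N$ be an iterated function system of contractive similitudes on $\mathbb{R}^d$ with self-similar set $K$. If $K$ has positive $d$-dimensional Lebesgue measure, or if the IFS satisfies the weak separation condition, then both graphs $(X,\mathcal{E})$ and $(X,\mathcal{E}^\diamond)$ are hyperbolic (with respect to the root $o$).
   Context: **IFS and symbolic space.** $\{S_j\}_{j=1}^N$ are similitudes of $\mathbb{R}^d$ with contraction ratios $0<r_j<1$, i.e. $|S_j(p)-S_j(q)|=r_j|p-q|$. $K$ is the self-similar set: the unique nonempty compact set with $K=\bigcup_{j=1}^N S_j(K)$. $\Sigma^*=\bigcup_{n\ge 0}\{1,\dots,N\}^n$ is the set of finite words, $o$ is the empty word. For $\mathbf{i}=i_1\cdots i_k$ put $S_{\mathbf{i}}=S_{i_1}\circ\cdots\circ S_{i_k}$ ($S_o=\mathrm{id}$) and $r_{\mathbf{i}}=r_{i_1}\cdots r_{i_k}$. Let $r=\min_j r_j$, $\mathcal{J}_0=\{o\}$, and for $n\ge1$ let $\mathcal{J}_n$ be the set of words $j_1\cdots j_k\in\Sigma^*$ (any length $k\ge 1$) with $r_{j_1}\cdots r_{j_k}\le r^n<r_{j_1}\cdots r_{j_{k-1}}$; $\mathcal{J}=\bigcup_{n\ge0}\mathcal{J}_n$ (a disjoint union). For $\mathbf{i}\in\mathcal{J}_n$ write $|\mathbf{i}|=n$ (the level of $\mathbf i$). Words $\mathbf{i},\mathbf{j}\in\mathcal{J}$ are equivalent, $\mathbf{i}\sim\mathbf{j}$, iff $S_{\mathbf{i}}=S_{\mathbf{j}}$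 (then $|\mathbf{i}|=|\mathbf{j}|$). $X=\mathcal{J}/\!\sim$; for $x=[\mathbf{i}]\in X$ put $S_x=S_{\mathbf{i}}$, $|x|=|\mathbf{i}|$. **Graphs (edges unordered).** $\mathcal{E}_v$: pairs $(x,y)$ with $|y|=|x|+1$ such that there are $\mathbf{i}\in x$, $\mathbf{j}\in y$, $\mathbf{k}\in\Sigma^*$ with $\mathbf{j}=\mathbf{i}\mathbf{k}$ (then $x$ is called an ancestor of $y$). $\mathcal{E}_v^+$: pairs $(x,y)$ with $|y|=|x|+1$, $S_x(K)\cap S_y(K)\ne\emptyset$, $x$ not an ancestor of $y$. $\mathcal{E}_h$: pairs $(x,y)$ with $x\neq y$, $|x|=|y|$, $S_x(K)\cap S_y(K)\neq\emptyset$. Set $\mathcal{E}=\mathcal{E}_v\cup\mathcal{E}_h$ and $\mathcal{E}^\diamond=\mathcal{E}_v\cup\mathcal{E}_v^+$. The root of both graphs is $o$; in both graphs the graph distance from $o$ to $x$ equals $|x|$. **Hyperbolicity.** For a connected graph with root $o$, graph metric $d$ and $|x|=d(o,x)$, the Gromov product is $|x\wedge y|=\frac12(|x|+|y|-d(x,y))$. The graph is hyperbolic if there is $\delta>0$ with $|x\wedge y|\ge\min\{|x\wedge z|,|z\wedge y|\}-\delta$ for all vertices $x,y,z$. **Weak separation condition (WSC).** There exist $\gamma>0$ and a compact $D\subset\mathbb{R}^d$ with nonempty interior and $\bigcup_{j=1}^N S_j(D)\subset D$ such that for all $n\ge1$ and $p\in\mathbb{R}^d$, $\#\{S\in\mathcal{A}_n: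 p\in S(D)\}\le\gamma$, where $\mathcal{A}_n=\{S_{\mathbf{i}}:\mathbf{i}\in\mathcal{J}_n\}$ (a set of maps). *)

theory Defs
  imports "HOL-Analysis.Analysis"
begin

section \<open>Graphs, graph metric and hyperbolicity\<close>

text \<open>
  An undirected graph is a vertex set \<open>V\<close> with a symmetric relation \<open>E\<close> on \<open>V\<close>:
  an unordered edge contributes both of its ordered pairs.
\<close>

definition undirected :: "('v \<times> 'v) set \<Rightarrow> ('v \<times> 'v) set" where
  "undirected R = R \<union> R\<inverse>"

definition connected_graph :: "'v set \<Rightarrow> ('v \<times> 'v) set \<Rightarrow> bool" where
  "connected_graph V E \<longleftrightarrow> (\<forall>x\<in>V. \<forall>y\<in>V. (x, y) \<in> E\<^sup>*)"

text \<open>Only meaningful for \<open>x\<close> and \<open>y\<close> joined by a path.\<close>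

definition graph_dist :: "('v \<times> 'v) set \<Rightarrow> 'v \<Rightarrow> 'v \<Rightarrow> nat" where
  "graph_dist E x y = (LEAST n. (x, y) \<in> E ^^ n)"

definition gromov_product :: "('v \<times> 'v) set \<Rightarrow> 'v \<Rightarrow> 'v \<Rightarrow> 'v \<Rightarrow> real" where
  "gromov_product E v0 x y =
     (real (graph_dist E v0 x) + real (graph_dist E v0 y) - real (graph_dist E x y)) / 2"

text \<open>
  Hyperbolicity is a notion for connected graphs; connectedness is made part of the predicate
  so that it never depends on the value of \<open>graph_dist\<close> between different components.
\<close>

definition hyperbolic_graph :: "'v set \<Rightarrow> ('v \<times> 'v) set \<Rightarrow> 'v \<Rightarrow> bool" where
  "hyperbolic_graph V E v0 \<longleftrightarrow>
     connected_graph V E \<and>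
     (\<exists>\<delta>>0. \<forall>x\<in>V. \<forall>y\<in>V. \<forall>z\<in>V.
        gromov_product E v0 x y
          \<ge> min (gromov_product E v0 x z) (gromov_product E v0 z y) - \<delta>)"


section \<open>Iterated function systems of similitudes\<close>

text \<open>The system is \<open>S 1, \<dots>, S N\<close>, with contraction ratios \<open>\<rho> 1, \<dots>, \<rho> N\<close>.\<close>

definition similitude_ifs ::
    "nat \<Rightarrow> (nat \<Rightarrow> 'a::euclidean_space \<Rightarrow> 'a) \<Rightarrow> (nat \<Rightarrow> real) \<Rightarrow> bool" where
  "similitude_ifs N S \<rho> \<longleftrightarrow>
     1 \<le> N \<and>
     (\<forall>j\<in>{1..N}. 0 < \<rho> j \<and> \<rho> j < 1 \<and> (\<forall>p q. dist (S j p) (S j q) = \<rho> j * dist p q))"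

text \<open>For contractions, exactly one set satisfies this predicate (Hutchinson).\<close>

definition self_similar_set ::
    "nat \<Rightarrow> (nat \<Rightarrow> 'a::euclidean_space \<Rightarrow> 'a) \<Rightarrow> 'a set \<Rightarrow> bool" where
  "self_similar_set N S K \<longleftrightarrow> compact K \<and> K \<noteq> {} \<and> K = (\<Union>j\<in>{1..N}. S j ` K)"

definition words :: "nat \<Rightarrow> nat list set" where
  "words N = {w. set w \<subseteq> {1..N}}"

definition word_map :: "(nat \<Rightarrow> 'a \<Rightarrow> 'a) \<Rightarrow> nat list \<Rightarrow> 'a \<Rightarrow> 'a" where
  "word_map S w = foldr (\<lambda>j f. S j \<circ> f) w id"

definition word_ratio :: "(nat \<Rightarrow> real) \<Rightarrow> nat list \<Rightarrow> real" where
  "word_ratio \<rho> w = prod_list (map \<rho> w)"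

definition min_ratio :: "nat \<Rightarrow> (nat \<Rightarrow> real) \<Rightarrow> real" where
  "min_ratio N \<rho> = Min (\<rho> ` {1..N})"

definition J_level :: "nat \<Rightarrow> (nat \<Rightarrow> real) \<Rightarrow> nat \<Rightarrow> nat list set" where
  "J_level N \<rho> n =
     (if n = 0 then {[]}
      else {w \<in> words N. w \<noteq> [] \<and>
              word_ratio \<rho> w \<le> min_ratio N \<rho> ^ n \<and>
              min_ratio N \<rho> ^ n < word_ratio \<rho> (butlast w)})"

definition J_all :: "nat \<Rightarrow> (nat \<Rightarrow> real) \<Rightarrow> nat list set" where
  "J_all N \<rho> = (\<Union>n. J_level N \<rho> n)"

text \<open>Well defined on \<open>J_all\<close>, since the sets \<open>J_level N \<rho> n\<close> are pairwise disjoint.\<close>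

definition word_level :: "nat \<Rightarrow> (nat \<Rightarrow> real) \<Rightarrow> nat list \<Rightarrow> nat" where
  "word_level N \<rho> w = (THE n. w \<in> J_level N \<rho> n)"

definition word_equiv ::
    "nat \<Rightarrow> (nat \<Rightarrow> 'a \<Rightarrow> 'a) \<Rightarrow> (nat \<Rightarrow> real) \<Rightarrow> (nat list \<times> nat list) set" where
  "word_equiv N S \<rho> =
     {(u, v). u \<in> J_all N \<rho> \<and> v \<in> J_all N \<rho> \<and> word_map S u = word_map S v}"

definition vertices ::
    "nat \<Rightarrow> (nat \<Rightarrow> 'a \<Rightarrow> 'a) \<Rightarrow> (nat \<Rightarrow> real) \<Rightarrow> nat list set set" where
  "vertices N S \<rho> = J_all N \<rho> // word_equiv N S \<rho>"

definition root_vertex ::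
    "nat \<Rightarrow> (nat \<Rightarrow> 'a \<Rightarrow> 'a) \<Rightarrow> (nat \<Rightarrow> real) \<Rightarrow> nat list set" where
  "root_vertex N S \<rho> = word_equiv N S \<rho> `` {[]}"

text \<open>
  The map and the level of a vertex are those of any of its representatives. Equivalent words have
  the same map, hence the same contraction ratio and the same level, so both images below are
  singletons.
\<close>

definition vertex_map :: "(nat \<Rightarrow> 'a \<Rightarrow> 'a) \<Rightarrow> nat list set \<Rightarrow> 'a \<Rightarrow> 'a" where
  "vertex_map S x = the_elem (word_map S ` x)"

definition vertex_level :: "nat \<Rightarrow> (nat \<Rightarrow> real) \<Rightarrow> nat list set \<Rightarrow> nat" where
  "vertex_level N \<rho> x = the_elem (word_level N \<rho> ` x)"


section \<open>The augmented graphs\<close>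

text \<open>Vertical edges are listed from the lower level to the higher one.\<close>

definition E_v ::
    "nat \<Rightarrow> (nat \<Rightarrow> 'a \<Rightarrow> 'a) \<Rightarrow> (nat \<Rightarrow> real) \<Rightarrow> (nat list set \<times> nat list set) set" where
  "E_v N S \<rho> =
     {(x, y). x \<in> vertices N S \<rho> \<and> y \<in> vertices N S \<rho> \<and>
        vertex_level N \<rho> y = vertex_level N \<rho> x + 1 \<and>
        (\<exists>u\<in>x. \<exists>v\<in>y. \<exists>w\<in>words N. v = u @ w)}"

definition E_v_plus ::
    "nat \<Rightarrow> (nat \<Rightarrow> 'a \<Rightarrow> 'a) \<Rightarrow> (nat \<Rightarrow> real) \<Rightarrow> 'a set \<Rightarrow> (nat list set \<times> nat list set) set" where
  "E_v_plus N S \<rho> K =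
     {(x, y). x \<in> vertices N S \<rho> \<and> y \<in> vertices N S \<rho> \<and>
        vertex_level N \<rho> y = vertex_level N \<rho> x + 1 \<and>
        vertex_map S x ` K \<inter> vertex_map S y ` K \<noteq> {} \<and>
        (x, y) \<notin> E_v N S \<rho>}"

definition E_h ::
    "nat \<Rightarrow> (nat \<Rightarrow> 'a \<Rightarrow> 'a) \<Rightarrow> (nat \<Rightarrow> real) \<Rightarrow> 'a set \<Rightarrow> (nat list set \<times> nat list set) set" where
  "E_h N S \<rho> K =
     {(x, y). x \<in> vertices N S \<rho> \<and> y \<in> vertices N S \<rho> \<and> x \<noteq> y \<and>
        vertex_level N \<rho> x = vertex_level N \<rho> y \<and>
        vertex_map S x ` K \<inter> vertex_map S y ` K \<noteq> {}}"

definition E_aug ::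
    "nat \<Rightarrow> (nat \<Rightarrow> 'a \<Rightarrow> 'a) \<Rightarrow> (nat \<Rightarrow> real) \<Rightarrow> 'a set \<Rightarrow> (nat list set \<times> nat list set) set" where
  "E_aug N S \<rho> K = undirected (E_v N S \<rho> \<union> E_h N S \<rho> K)"

definition E_diamond ::
    "nat \<Rightarrow> (nat \<Rightarrow> 'a \<Rightarrow> 'a) \<Rightarrow> (nat \<Rightarrow> real) \<Rightarrow> 'a set \<Rightarrow> (nat list set \<times> nat list set) set" where
  "E_diamond N S \<rho> K = undirected (E_v N S \<rho> \<union> E_v_plus N S \<rho> K)"


section \<open>The weak separation condition\<close>

definition level_maps ::
    "nat \<Rightarrow> (nat \<Rightarrow> 'a \<Rightarrow> 'a) \<Rightarrow> (nat \<Rightarrow> real) \<Rightarrow> nat \<Rightarrow> ('a \<Rightarrow> 'a) set" where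
  "level_maps N S \<rho> n = word_map S ` J_level N \<rho> n"

text \<open>
  The finiteness conjunct only guards against \<open>card\<close> of an infinite set being \<open>0\<close>; it always
  holds for a similitude system, as each \<open>J_level N \<rho> n\<close> is finite.
\<close>

definition weak_separation ::
    "nat \<Rightarrow> (nat \<Rightarrow> 'a::euclidean_space \<Rightarrow> 'a) \<Rightarrow> (nat \<Rightarrow> real) \<Rightarrow> bool" where
  "weak_separation N S \<rho> \<longleftrightarrow>
     (\<exists>(\<gamma>::real) D. \<gamma> > 0 \<and> compact D \<and> interior D \<noteq> {} \<and> (\<Union>j\<in>{1..N}. S j ` D) \<subseteq> D \<and>
        (\<forall>n\<ge>1. \<forall>p. finite {T \<in> level_maps N S \<rho> n. p \<in> T ` D} \<and>
           real (card {T \<in> level_maps N S \<rho> n. p \<in> T ` D}) \<le> \<gamma>))"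

end

theory Submission
  imports Defs
begin

text \<open>
  Every vertex \<open>x\<close> carries the cell \<open>S\<^sub>x(K)\<close>, of diameter comparable to \<open>r ^ lev x\<close>, and all edges of
  either graph join vertices of intersecting cells whose levels differ by at most one. Given
  \<open>x\<close>, \<open>y\<close>, \<open>z\<close>, let \<open>k\<close> be the integer part of the smaller of the Gromov products of \<open>x, z\<close> and
  \<open>z, y\<close>. Geodesics from \<open>x\<close> to \<open>z\<close> to \<open>y\<close> stay at levels \<open>\<ge> k\<close>, and their cells have diameters
  summing to \<open>O(r ^ k)\<close>; replacing each vertex by its ancestor at level \<open>k\<close> gives a chain of
  intersecting level-\<open>k\<close> cells inside a ball of radius \<open>O(r ^ k)\<close>. Within such a ball a shortest
  chain has bounded length, by comparing volumes, so \<open>d(x, y) \<le> lev x + lev y - 2 k + O(1)\<close>.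
\<close>

section \<open>Measure of similar sets\<close>

text \<open>The Jacobian \<open>\<bar>c\<bar> ^ DIM('a)\<close> of the substitution is 1.
  Translations (c = 1) and point reflections (c = -1) are treated at once because the double
  integral below needs both.\<close>

lemma nn_integral_lborel_shift_reflect:
  fixes f :: "'a::euclidean_space \<Rightarrow> ennreal"
  assumes [measurable]: "f \<in> borel_measurable borel" and c: "\<bar>c\<bar> = 1"
  shows "(\<integral>\<^sup>+x. f (t + c *\<^sub>R x) \<partial>lborel) = (\<integral>\<^sup>+x. f x \<partial>lborel)"
proof -
  have "c \<noteq> 0" using c by auto
  have "(\<integral>\<^sup>+x. f x \<partial>lborel)
      = (\<integral>\<^sup>+x. f x \<partial>density (distr lborel borel (\<lambda>x. t + c *\<^sub>R x)) (\<lambda>_. \<bar>c\<bar>^DIM('a)))"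
    using lborel_affine[OF \<open>c \<noteq> 0\<close>, of t] by (rule arg_cong)
  also have "\<dots> = (\<integral>\<^sup>+x. f (t + c *\<^sub>R x) \<partial>lborel)"
    by (simp add: c nn_integral_density nn_integral_distr)
  finally show ?thesis by simp
qed

text \<open>
  Both sides, multiplied by the volume of the unit ball \<open>U\<close>, are the double integral of
  \<open>1\<^sub>A(x) 1\<^sub>U(T y - x)\<close>, evaluated in the two orders.
\<close>

lemma emeasure_orthogonal_vimage:
  fixes T :: "'a::euclidean_space \<Rightarrow> 'a"
  assumes T: "orthogonal_transformation T" and A [measurable]: "A \<in> sets borel"
  shows "emeasure lborel (T -` A) = emeasure lborel A"
proof -
  define U where "U = ball (0::'a) 1"
  have U [measurable]: "U \<in> sets borel" by (simp add: U_def)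
  have lin: "linear T" using T by (rule orthogonal_transformation_linear)
  have [measurable]: "T \<in> borel_measurable borel"
    using lin
    by (intro borel_measurable_continuous_onI) (simp add: linear_continuous_on linear_conv_bounded_linear)
  have "bij T" using T by (rule orthogonal_transformation_bij)
  then have TT: "T (inv T x) = x" for x
    by (simp add: bij_is_surj surj_f_inv_f)
  have UT: "T z \<in> U \<longleftrightarrow> z \<in> U" "- z \<in> U \<longleftrightarrow> z \<in> U" for z
    using orthogonal_transformation_norm[OF T, of z] by (auto simp: U_def dist_norm)
  have VA [measurable]: "T -` A \<in> sets borel"
    using measurable_sets[of T borel borel A] by simp
  have *: "(\<integral>\<^sup>+y. indicator B (T (y - w)) \<partial>lborel) = emeasure lborel (T -` B)"
    if [measurable]: "B \<in> sets borel" for B w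
  proof -
    have [measurable]: "T -` B \<in> sets borel"
      using measurable_sets[of T borel borel B] by simp
    have "(\<integral>\<^sup>+y. indicator B (T (y - w)) \<partial>lborel) = (\<integral>\<^sup>+y. indicator (T -` B) (- w + 1 *\<^sub>R y) \<partial>lborel)"
      by (intro nn_integral_cong) (auto simp: indicator_def)
    also have "\<dots> = (\<integral>\<^sup>+y. indicator (T -` B) y \<partial>lborel)"
      by (intro nn_integral_lborel_shift_reflect) auto
    finally show ?thesis by simp
  qed
  have "emeasure lborel A * emeasure lborel U
      = (\<integral>\<^sup>+x. indicator A x * emeasure lborel U \<partial>lborel)"
    by (simp add: nn_integral_multc)
  also have "\<dots> = (\<integral>\<^sup>+x. (\<integral>\<^sup>+y. indicator A x * indicator U (T y - x) \<partial>lborel) \<partial>lborel)"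
  proof (rule nn_integral_cong)
    \<comment> \<open>Writing x as \<open>T (inv T x)\<close> turns T y - x into T (y -
      \<open>inv T x\<close>); translation invariance and the invariance of the ball U under T then
      give the volume of U.\<close>
    fix x :: 'a
    have "(\<integral>\<^sup>+y. indicator A x * indicator U (T y - x) \<partial>lborel)
        = indicator A x * (\<integral>\<^sup>+y. indicator U (T (y - inv T x)) \<partial>lborel)"
      by (subst nn_integral_cmult[symmetric]) (auto simp: linear_diff[OF lin] TT)
    also have "(\<integral>\<^sup>+y. indicator U (T (y - inv T x)) \<partial>lborel) = emeasure lborel U"
      using *[OF U, of "inv T x"] UT(1) by (simp add: vimage_def)
    finally show "indicator A x * emeasure lborel U
        = (\<integral>\<^sup>+y. indicator A x * indicator U (T y - x) \<partial>lborel)" by simp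
  qed
  also have "\<dots> = (\<integral>\<^sup>+y. (\<integral>\<^sup>+x. indicator A x * indicator U (T y - x) \<partial>lborel) \<partial>lborel)"
    by (rule lborel_pair.Fubini'[symmetric]) (auto simp: case_prod_beta)
  also have "\<dots> = (\<integral>\<^sup>+y. (\<integral>\<^sup>+z. indicator A (T y - z) * indicator U z \<partial>lborel) \<partial>lborel)"
  proof (rule nn_integral_cong)
    \<comment> \<open>The reflection x -> T y - x moves the dependence on y from U to A, so that y
      can be integrated out first.\<close>
    fix y :: 'a
    have "(\<integral>\<^sup>+x. indicator A x * indicator U (T y - x) \<partial>lborel)
       = (\<integral>\<^sup>+x. (\<lambda>x. indicator A x * indicator U (T y - x)) (T y + (-1) *\<^sub>R x) \<partial>lborel)"
      by (rule nn_integral_lborel_shift_reflect[symmetric]) auto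
    then show "(\<integral>\<^sup>+x. indicator A x * indicator U (T y - x) \<partial>lborel)
       = (\<integral>\<^sup>+z. indicator A (T y - z) * indicator U z \<partial>lborel)" by simp
  qed
  also have "\<dots> = (\<integral>\<^sup>+z. (\<integral>\<^sup>+y. indicator A (T y - z) * indicator U z \<partial>lborel) \<partial>lborel)"
    by (rule lborel_pair.Fubini'[symmetric]) (auto simp: case_prod_beta)
  also have "\<dots> = (\<integral>\<^sup>+z. emeasure lborel (T -` A) * indicator U z \<partial>lborel)"
  proof (rule nn_integral_cong)
    fix z :: 'a
    have "(\<integral>\<^sup>+y. indicator A (T y - z) * indicator U z \<partial>lborel)
      = (\<integral>\<^sup>+y. indicator A (T (y - inv T z)) \<partial>lborel) * indicator U z"
      by (subst nn_integral_multc[symmetric]) (auto simp: linear_diff[OF lin] TT)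
    then show "(\<integral>\<^sup>+y. indicator A (T y - z) * indicator U z \<partial>lborel)
      = emeasure lborel (T -` A) * indicator U z"
      by (simp only: *[OF A])
  qed
  also have "\<dots> = emeasure lborel (T -` A) * emeasure lborel U"
    by (simp add: nn_integral_cmult)
  finally have eq: "emeasure lborel A * emeasure lborel U = emeasure lborel (T -` A) * emeasure lborel U" .
  \<comment> \<open>Cancellation in \<open>ennreal\<close> needs a factor that is neither zero nor
    infinite.\<close>
  have "emeasure lborel U \<noteq> 0" "emeasure lborel U \<noteq> \<infinity>"
    using content_ball_pos[of 1 "0::'a"] emeasure_lborel_ball_finite[of "0::'a" 1]
    by (auto simp: U_def measure_def)
  with eq show ?thesis
    by (simp add: mult.commute[of _ "emeasure lborel U"] ennreal_mult_cancel_left)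
qed

text \<open>The displacement from f 0, divided by c, is an isometry fixing 0; in an inner product
  space such a map is linear.\<close>

lemma similitude_decompose:
  fixes f :: "'a::real_inner \<Rightarrow> 'a"
  assumes f: "\<And>p q. dist (f p) (f q) = c * dist p q" and c: "c > 0"
  obtains T where "orthogonal_transformation T" "\<And>x. f x = c *\<^sub>R T x + f 0"
proof -
  define T where "T x = (1 / c) *\<^sub>R (f x - f 0)" for x
  have "dist (T x) (T y) = dist x y" for x y
  proof -
    have "T x - T y = (1 / c) *\<^sub>R (f x - f y)"
      by (simp add: T_def algebra_simps)
    then show ?thesis using f[of x y] c by (simp add: dist_norm)
  qed
  then have "orthogonal_transformation T"
    by (auto simp: orthogonal_transformation_isometry T_def)
  moreover have "f x = c *\<^sub>R T x + f 0" for x using c by (simp add: T_def)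
  ultimately show thesis using that by blast
qed

text \<open>The orthogonal part preserves volume and the homothety contributes the factor. The
  affine formula concerns \<open>lebesgue\<close>; compactness makes all sets Borel, so it carries
  over to \<open>lborel\<close>.\<close>

lemma measure_similitude_image:
  fixes f :: "'a::euclidean_space \<Rightarrow> 'a"
  assumes f: "\<And>p q. dist (f p) (f q) = c * dist p q" and c: "c > 0" and A: "compact A"
  shows "measure lborel (f ` A) = c ^ DIM('a) * measure lborel A"
proof -
  obtain T where T: "orthogonal_transformation T" and fT: "\<And>x. f x = c *\<^sub>R T x + f 0"
    using similitude_decompose[OF f c] by blast
  have cont: "continuous_on A T"
    using orthogonal_transformation_linear[OF T]
    by (simp add: linear_continuous_on linear_conv_bounded_linear)
  have cTA: "compact (T ` A)" using cont A by (rule compact_continuous_image)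
  have comp: "compact ((\<lambda>x. c *\<^sub>R x + f 0) ` T ` A)"
    by (intro compact_continuous_image cTA continuous_intros)
  have im: "f ` A = (\<lambda>x. c *\<^sub>R x + f 0) ` T ` A"
    unfolding image_image by (intro image_cong refl fT)
  have "T -` (T ` A) = A"
    using orthogonal_transformation_inj[OF T] by (simp add: inj_vimage_image_eq)
  then have "emeasure lborel A = emeasure lborel (T ` A)"
    using emeasure_orthogonal_vimage[OF T, of "T ` A"] cTA by (simp add: borel_compact)
  then have "measure lborel A = measure lborel (T ` A)" by (simp add: measure_def)
  moreover have "measure lebesgue (f ` A) = c ^ DIM('a) * measure lebesgue (T ` A)"
    using measure_lebesgue_affine[of c "f 0" "T ` A"] c by (simp add: im)
  ultimately show ?thesis
    using A cTA comp im by (simp add: measure_completion borel_compact)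
qed

section \<open>A hyperbolicity criterion\<close>

lemma sym_relpow:
  assumes "sym E" shows "sym (E ^^ n)"
proof (induction n)
  case (Suc n)
  show ?case
  proof (rule symI)
    fix x y assume "(x, y) \<in> E ^^ Suc n"
    then obtain z where "(x, z) \<in> E ^^ n" "(z, y) \<in> E" by auto
    then have "(z, x) \<in> E ^^ n" "(y, z) \<in> E"
      using Suc assms by (auto dest: symD)
    then show "(y, x) \<in> E ^^ Suc n" by (rule relpow_Suc_I2[rotated])
  qed
qed (auto simp: sym_def)

lemma graph_dist_le: "(x, y) \<in> E ^^ n \<Longrightarrow> graph_dist E x y \<le> n"
  unfolding graph_dist_def by (rule Least_le)

lemma relpow_graph_dist: "(x, y) \<in> E\<^sup>* \<Longrightarrow> (x, y) \<in> E ^^ graph_dist E x y"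
  unfolding graph_dist_def by (rule LeastI_ex) (simp add: rtrancl_power)

lemma sum_power_abs_diff_le:
  fixes r :: real
  assumes r: "0 < r" "r < 1"
  shows "(\<Sum>j\<le>L. r ^ nat \<bar>int j - int m\<bar>) \<le> 2 / (1 - r)"
proof -
  let ?g = "\<lambda>j. r ^ nat \<bar>int j - int m\<bar>"
  have geo: "(\<Sum>i\<le>n. r ^ i) \<le> 1 / (1 - r)" for n
    using r by (subst sum_gp0) (auto simp: divide_simps)
  \<comment> \<open>The indices up to m are counted downwards from m, the others upwards. Each side
    is a geometric sum; overlap and overshoot only add nonnegative terms.\<close>
  have L: "{..L} \<subseteq> (\<lambda>i. m - i) ` {..m} \<union> (\<lambda>i. m + i) ` {..L}"
  proof
    fix j assume j: "j \<in> {..L}"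
    show "j \<in> (\<lambda>i. m - i) ` {..m} \<union> (\<lambda>i. m + i) ` {..L}"
    proof (cases "j \<le> m")
      case True
      then have "j = m - (m - j)" "m - j \<in> {..m}" by auto
      then show ?thesis by blast
    next
      case False
      then have "j = m + (j - m)" "j - m \<in> {..L}" using j by auto
      then show ?thesis by blast
    qed
  qed
  have "(\<Sum>j\<le>L. ?g j) \<le> sum ?g ((\<lambda>i. m - i) ` {..m} \<union> (\<lambda>i. m + i) ` {..L})"
    using r by (intro sum_mono2 L) auto
  also have "\<dots> \<le> sum ?g ((\<lambda>i. m - i) ` {..m}) + sum ?g ((\<lambda>i. m + i) ` {..L})"
    using r by (subst sum.union_inter[symmetric]) (auto intro!: sum_nonneg)
  also have "sum ?g ((\<lambda>i. m - i) ` {..m}) \<le> (\<Sum>i\<le>m. ?g (m - i))"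
    using r sum_image_le[of "{..m}" ?g "\<lambda>i. m - i"] by (simp add: o_def)
  also have "(\<Sum>i\<le>m. ?g (m - i)) = (\<Sum>i\<le>m. r ^ i)"
    by (intro sum.cong) auto
  also have "\<dots> \<le> 1 / (1 - r)" by (rule geo)
  also have "sum ?g ((\<lambda>i. m + i) ` {..L}) \<le> (\<Sum>i\<le>L. ?g (m + i))"
    using r sum_image_le[of "{..L}" ?g "\<lambda>i. m + i"] by (simp add: o_def)
  also have "(\<Sum>i\<le>L. ?g (m + i)) = (\<Sum>i\<le>L. r ^ i)"
    by (intro sum.cong) auto
  also have "\<dots> \<le> 1 / (1 - r)" by (rule geo)
  finally show ?thesis by simp
qed

text \<open>Confinement to the ball is part of every step, so all vertices of a nonempty chain have
  their cells in the ball. A vertex with a nonempty cell in the ball is related to itself.\<close>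

definition cell_rel ::
    "'v set \<Rightarrow> ('v \<Rightarrow> nat) \<Rightarrow> ('v \<Rightarrow> 'a::metric_space set) \<Rightarrow> nat \<Rightarrow> 'a \<Rightarrow> real \<Rightarrow> ('v \<times> 'v) set" where
  "cell_rel V lev T n c s =
     {(a, b). a \<in> V \<and> b \<in> V \<and> lev a = n \<and> lev b = n \<and>
        T a \<subseteq> cball c s \<and> T b \<subseteq> cball c s \<and> T a \<inter> T b \<noteq> {}}"

text \<open>The common features of the two augmented graphs. No horizontal edges are demanded, which
  admits \<open>E_diamond\<close>. \<open>edge_lev\<close> is one-sided because \<open>sym_E\<close>
  supplies the other bound.\<close>

locale cell_graph =
  fixes V :: "'v set" and E :: "('v \<times> 'v) set" and v0 :: 'v
    and lev :: "'v \<Rightarrow> nat" and T :: "'v \<Rightarrow> 'a::metric_space set"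
    and C r :: real
  assumes r: "0 < r" "r < 1"
    and root: "v0 \<in> V" "\<And>x. x \<in> V \<Longrightarrow> lev x = 0 \<longleftrightarrow> x = v0"
    and edge_in: "(x, y) \<in> E \<Longrightarrow> x \<in> V \<and> y \<in> V"
    and sym_E: "sym E"
    and edge_lev: "(x, y) \<in> E \<Longrightarrow> lev y \<le> lev x + 1"
    and edge_meet: "(x, y) \<in> E \<Longrightarrow> T x \<inter> T y \<noteq> {}"
    and ancestor: "x \<in> V \<Longrightarrow> k \<le> lev x \<Longrightarrow>
      \<exists>a\<in>V. lev a = k \<and> T x \<subseteq> T a \<and> (x, a) \<in> E ^^ (lev x - k)"
    and cell_ne: "x \<in> V \<Longrightarrow> T x \<noteq> {}"
    and cell_diam: "x \<in> V \<Longrightarrow> p \<in> T x \<Longrightarrow> q \<in> T x \<Longrightarrow> dist p q \<le> C * r ^ lev x"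
begin

section \<open>Levels, geodesics and ancestors in a cell graph\<close>

lemma C_nonneg: "0 \<le> C"
proof -
  obtain p where "p \<in> T v0" using cell_ne root by blast
  then have "dist p p \<le> C * r ^ lev v0" by (intro cell_diam root)
  moreover have "lev v0 = 0" using root by simp
  ultimately show ?thesis by simp
qed

lemma relpow_lev: "(x, y) \<in> E ^^ n \<Longrightarrow> lev y \<le> lev x + n"
proof (induction n arbitrary: y)
  case (Suc n)
  then obtain z where "(x, z) \<in> E ^^ n" "(z, y) \<in> E" by auto
  then show ?case using Suc.IH[of z] edge_lev[of z y] by auto
qed auto

lemma relpow_root: "x \<in> V \<Longrightarrow> (v0, x) \<in> E ^^ lev x"
  using ancestor[of x 0] root symD[OF sym_relpow[OF sym_E]] by fastforce

lemma graph_dist_root: "x \<in> V \<Longrightarrow> graph_dist E v0 x = lev x"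
proof (rule antisym)
  assume x: "x \<in> V"
  then have p: "(v0, x) \<in> E ^^ lev x" by (rule relpow_root)
  then show "graph_dist E v0 x \<le> lev x" by (rule graph_dist_le)
  have "(v0, x) \<in> E ^^ graph_dist E v0 x"
    using p by (intro relpow_graph_dist) (auto simp: rtrancl_power)
  moreover have "lev v0 = 0" using root by simp
  ultimately show "lev x \<le> graph_dist E v0 x"
    using relpow_lev by fastforce
qed

lemma relpow_via_root: "x \<in> V \<Longrightarrow> y \<in> V \<Longrightarrow> (x, y) \<in> E ^^ (lev x + lev y)"
  using relpow_root[of x] relpow_root[of y] symD[OF sym_relpow[OF sym_E]] by (auto simp: relpow_add)

lemma connected: "connected_graph V E"
  unfolding connected_graph_def using relpow_via_root by (auto simp: rtrancl_power)

lemma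
  assumes "x \<in> V" "y \<in> V"
  shows geodesic: "(x, y) \<in> E ^^ graph_dist E x y"
    and graph_dist_le_via_root: "graph_dist E x y \<le> lev x + lev y"
  using relpow_via_root[OF assms] relpow_graph_dist[of x y E] graph_dist_le[of x y _ E]
  by (auto simp: rtrancl_power)

text \<open>
  A walk of length \<open>L\<close> from \<open>z\<close> to \<open>x\<close> with \<open>2 k + L \<le> lev z + lev x\<close> sits at level at least
  \<open>k + \<bar>j - (lev z - k)\<bar>\<close> at time \<open>j\<close>, so the diameters of its cells add up to \<open>O(r ^ k)\<close>.
\<close>

lemma walk_level:
  assumes f: "f 0 = z" "f L = x" "\<And>i. i < L \<Longrightarrow> (f i, f (Suc i)) \<in> E"
    and k: "2 * k + L \<le> lev z + lev x" "k \<le> lev z" and j: "j \<le> L"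
  shows "k + nat \<bar>int j - int (lev z - k)\<bar> \<le> lev (f j)"
proof -
  have "(f 0, f j) \<in> E ^^ j"
    unfolding relpow_fun_conv using f(3) j by (intro exI[of _ f]) auto
  then have "(f j, z) \<in> E ^^ j"
    using f(1) symD[OF sym_relpow[OF sym_E]] by auto
  then have 1: "lev z \<le> lev (f j) + j" by (rule relpow_lev)
  have "(f j, f L) \<in> E ^^ (L - j)"
    unfolding relpow_fun_conv using f(3) j by (intro exI[of _ "\<lambda>i. f (j + i)"]) auto
  then have "lev x \<le> lev (f j) + (L - j)" using f(2) relpow_lev by blast
  \<comment> \<open>Walking back to z gives level at least lev z - j, walking on to x gives at least
    lev x - (L - j). By the choice of k the larger of the two bounds is at least the claimed
    one.\<close>
  with 1 k j show ?thesis by (auto simp: nat_le_iff)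
qed

text \<open>Consecutive cells meet, so c and p are joined by hops inside the cells at times 0 to j,
  each costing at most one diameter. By \<open>walk_level\<close> these diameters are dominated by
  two geometric progressions starting at C * r ^ k.\<close>

lemma walk_dist:
  assumes f: "f 0 = z" "f L = x" "\<And>i. i < L \<Longrightarrow> (f i, f (Suc i)) \<in> E" and z: "z \<in> V"
    and k: "2 * k + L \<le> lev z + lev x" "k \<le> lev z" and j: "j \<le> L"
    and c: "c \<in> T z" and p: "p \<in> T (f j)"
  shows "dist c p \<le> 2 * C / (1 - r) * r ^ k"
proof -
  have inV: "f i \<in> V" if "i \<le> L" for i
    using that f z edge_in by (cases i) (auto simp: less_Suc_eq_le[symmetric])
  have "dist c p \<le> (\<Sum>i\<le>j. C * r ^ lev (f i))"
    using j p
  proof (induction j arbitrary: p)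
    case 0
    then show ?case using c f(1) z cell_diam[of z c p] by simp
  next
    case (Suc j)
    then obtain q where q: "q \<in> T (f j)" "q \<in> T (f (Suc j))"
      using edge_meet[OF f(3)[of j]] by auto
    have "dist c p \<le> dist c q + dist q p" by (rule dist_triangle)
    also have "\<dots> \<le> (\<Sum>i\<le>j. C * r ^ lev (f i)) + C * r ^ lev (f (Suc j))"
      using Suc q by (intro add_mono Suc.IH cell_diam inV) auto
    finally show ?case by simp
  qed
  also have "\<dots> \<le> (\<Sum>i\<le>j. C * (r ^ k * r ^ nat \<bar>int i - int (lev z - k)\<bar>))"
    using walk_level[OF f k] r C_nonneg j
    by (intro sum_mono mult_left_mono) (auto simp: power_add[symmetric] intro!: power_decreasing)
  also have "\<dots> = C * r ^ k * (\<Sum>i\<le>j. r ^ nat \<bar>int i - int (lev z - k)\<bar>)"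
    by (simp add: sum_distrib_left mult.assoc)
  also have "\<dots> \<le> C * r ^ k * (2 / (1 - r))"
    using r C_nonneg by (intro mult_left_mono sum_power_abs_diff_le) auto
  finally show ?thesis by (simp add: field_simps)
qed

text \<open>An arbitrary choice suffices: ancestors chosen for different vertices or levels need not
  be compatible, since only the inclusion of cells and the length of the connecting walk are
  used.\<close>

definition anc :: "nat \<Rightarrow> 'v \<Rightarrow> 'v" where
  "anc k x = (SOME a. a \<in> V \<and> lev a = k \<and> T x \<subseteq> T a \<and> (x, a) \<in> E ^^ (lev x - k))"

lemma anc:
  assumes "x \<in> V" "k \<le> lev x"
  shows "anc k x \<in> V" "lev (anc k x) = k" "T x \<subseteq> T (anc k x)" "(x, anc k x) \<in> E ^^ (lev x - k)"
  using someI_ex[of "\<lambda>a. a \<in> V \<and> lev a = k \<and> T x \<subseteq> T a \<and> (x, a) \<in> E ^^ (lev x - k)"]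
    ancestor[OF assms] unfolding anc_def by blast+

text \<open>Passing to ancestors enlarges the cells, so consecutive ones still meet. In the radius,
  2 / (1 - r) reaches some point of a geodesic cell by \<open>walk_dist\<close>, and the extra 1 is
  the diameter of the ancestor cell around it.\<close>

lemma anc_chain:
  assumes V: "z \<in> V" "x \<in> V" and k: "2 * k + graph_dist E z x \<le> lev z + lev x" "k \<le> lev z"
    and c: "c \<in> T z"
  shows "(anc k z, anc k x) \<in> (cell_rel V lev T k c (C * (1 + 2 / (1 - r)) * r ^ k))\<^sup>*"
    (is "_ \<in> ?R\<^sup>*")
proof -
  let ?L = "graph_dist E z x"
  obtain f where f: "f 0 = z" "f ?L = x" "\<And>i. i < ?L \<Longrightarrow> (f i, f (Suc i)) \<in> E"
    using geodesic[OF V] unfolding relpow_fun_conv by blast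
  have inV: "f i \<in> V" if "i \<le> ?L" for i
    using that f V edge_in by (cases i) (auto simp: less_Suc_eq_le[symmetric])
  have kl: "k \<le> lev (f j)" if "j \<le> ?L" for j
    using walk_level[OF f k that] by simp
  have ball: "T (anc k (f j)) \<subseteq> cball c (C * (1 + 2 / (1 - r)) * r ^ k)" if j: "j \<le> ?L" for j
  proof
    fix p assume p: "p \<in> T (anc k (f j))"
    obtain q where q: "q \<in> T (f j)" using cell_ne inV j by blast
    have "dist c p \<le> dist c q + dist q p" by (rule dist_triangle)
    also have "dist c q \<le> 2 * C / (1 - r) * r ^ k"
      using walk_dist[OF f V(1) k j c q] .
    also have "dist q p \<le> C * r ^ k"
      using cell_diam[of "anc k (f j)" q p] anc[OF inV[OF j] kl[OF j]] p q by auto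
    finally show "p \<in> cball c (C * (1 + 2 / (1 - r)) * r ^ k)"
      by (simp add: algebra_simps)
  qed
  have "(anc k z, anc k (f j)) \<in> ?R\<^sup>*" if "j \<le> ?L" for j
    using that
  proof (induction j)
    case (Suc j)
    \<comment> \<open>The two ancestors may coincide; the pair is then a loop, which
      \<open>cell_rel\<close> admits.\<close>
    have "(anc k (f j), anc k (f (Suc j))) \<in> ?R"
      using Suc.prems ball[of j] ball[of "Suc j"] edge_meet[OF f(3)[of j]]
        anc[OF inV kl, of j] anc[OF inV kl, of "Suc j"]
      unfolding cell_rel_def by auto
    then show ?case using Suc by (meson Suc_leD rtrancl.rtrancl_into_rtrancl)
  qed (use f in auto)
  from this[of ?L] f show ?thesis by simp
qed

text \<open>The assumption is uniform over scales and centres: M depends on B alone. It is the only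
  place where the geometry of the ambient space enters.\<close>

theorem hyperbolic:
  assumes chain: "\<And>B. \<exists>M. \<forall>n c a b. (a, b) \<in> (cell_rel V lev T n c (B * r ^ n))\<^sup>* \<longrightarrow>
      (\<exists>m\<le>M. (a, b) \<in> E ^^ m)"
  shows "hyperbolic_graph V E v0"
proof -
  obtain M where M: "\<And>n c a b. (a, b) \<in> (cell_rel V lev T n c (C * (1 + 2 / (1 - r)) * r ^ n))\<^sup>* \<Longrightarrow>
      \<exists>m\<le>M. (a, b) \<in> E ^^ m"
    using chain[of "C * (1 + 2 / (1 - r))"] by blast
  have "gromov_product E v0 x y
      \<ge> min (gromov_product E v0 x z) (gromov_product E v0 z y) - (real M + 1)"
    if V: "x \<in> V" "y \<in> V" "z \<in> V" for x y z
  proof -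
    have gd_sym: "graph_dist E a b = graph_dist E b a" for a b
      unfolding graph_dist_def using symD[OF sym_relpow[OF sym_E]] by metis
    \<comment> \<open>The integer part of the smaller Gromov product. The subtractions do not
      truncate, because a distance never exceeds the length of the detour through the root.\<close>
    define k where "k = min ((lev z + lev x - graph_dist E z x) div 2) ((lev z + lev y - graph_dist E z y) div 2)"
    have k: "2 * k + graph_dist E z x \<le> lev z + lev x" "2 * k + graph_dist E z y \<le> lev z + lev y"
      using graph_dist_le_via_root[OF V(3,1)] graph_dist_le_via_root[OF V(3,2)]
      by (auto simp: k_def)
    have k': "lev z + lev x \<le> 2 * k + 1 + graph_dist E z x \<or> lev z + lev y \<le> 2 * k + 1 + graph_dist E z y"
      by (auto simp: k_def min_def)
    \<comment> \<open>Levels of two vertices differ by at most their distance, so a Gromov product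
      is at most either level.\<close>
    have kl: "k \<le> lev x" "k \<le> lev y" "k \<le> lev z"
      using relpow_lev[OF geodesic[OF V(3,1)]] relpow_lev[OF geodesic[OF V(3,2)]] k
        relpow_lev[OF geodesic[OF V(1,3)]] relpow_lev[OF geodesic[OF V(2,3)]]
      by (auto simp: gd_sym[of _ z])
    obtain c where c: "c \<in> T z" using cell_ne V by blast
    let ?R = "cell_rel V lev T k c (C * (1 + 2 / (1 - r)) * r ^ k)"
    have "sym ?R" by (auto simp: cell_rel_def sym_def)
    then have "(anc k x, anc k z) \<in> ?R\<^sup>*"
      using anc_chain[OF V(3,1) k(1) kl(3) c] sym_rtrancl by (metis symD)
    \<comment> \<open>Both chains contain the same chosen vertex \<open>anc k z\<close> and live in
      the same ball around c, hence they can be concatenated.\<close>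
    then have "(anc k x, anc k y) \<in> ?R\<^sup>*"
      using anc_chain[OF V(3,2) k(2) kl(3) c] by (rule rtrancl_trans)
    then obtain m where m: "m \<le> M" "(anc k x, anc k y) \<in> E ^^ m" using M by blast
    \<comment> \<open>Up from x to level k, across in m steps, and down to y.\<close>
    have "(x, y) \<in> E ^^ (lev x - k + (m + (lev y - k)))"
      using anc(4)[OF V(1) kl(1)] symD[OF sym_relpow[OF sym_E] anc(4)[OF V(2) kl(2)]] m(2)
      by (auto simp: relpow_add)
    then have "graph_dist E x y \<le> lev x - k + (m + (lev y - k))" by (rule graph_dist_le)
    then have "real (graph_dist E x y) \<le> real (lev x - k + (m + (lev y - k)))"
      by (rule of_nat_mono)
    then have 1: "real (graph_dist E x y) \<le> real (lev x) + real (lev y) - 2 * real k + real M"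
      using kl m(1) by (simp add: of_nat_diff)
    have 2: "min (gromov_product E v0 x z) (gromov_product E v0 z y) \<le> real k + 1"
      using k' unfolding gromov_product_def
      by (auto simp: graph_dist_root V gd_sym[of x z] min_le_iff_disj)
    \<comment> \<open>The product of x and y is at least k - M / 2 and the minimum at most k + 1, so
      M + 1 works and is positive even for M = 0.\<close>
    show ?thesis
      using 1 2 by (simp add: gromov_product_def[of _ _ x y] graph_dist_root V field_simps)
  qed
  then show ?thesis
    unfolding hyperbolic_graph_def using connected by (intro conjI exI[of _ "real M + 1"]) auto
qed

end

section \<open>Chains of cells in a ball\<close>

text \<open>In a walk of minimal length a repeated vertex, or a related pair of indices more than
  one apart, would permit a shortcut.\<close>

lemma rtrancl_shortest_walk:
  assumes "(a, b) \<in> R\<^sup>*"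
  obtains f m where "f 0 = a" "f m = b" "\<And>i. i < m \<Longrightarrow> (f i, f (Suc i)) \<in> R"
    "inj_on f {..m}" "\<And>i j. Suc i < j \<Longrightarrow> j \<le> m \<Longrightarrow> (f i, f j) \<notin> R"
proof -
  define m where "m = graph_dist R a b"
  have "(a, b) \<in> R ^^ m" unfolding m_def by (rule relpow_graph_dist[OF assms])
  then obtain f where f: "f 0 = a" "f m = b" "\<And>i. i < m \<Longrightarrow> (f i, f (Suc i)) \<in> R"
    unfolding relpow_fun_conv by blast
  have start: "(a, f i) \<in> R ^^ i" if "i \<le> m" for i
    unfolding relpow_fun_conv using f that by (intro exI[of _ f]) auto
  have rest: "(f j, b) \<in> R ^^ (m - j)" if "j \<le> m" for j
    unfolding relpow_fun_conv using f that by (intro exI[of _ "\<lambda>i. f (j + i)"]) auto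
  have short: "m \<le> l" if "(a, b) \<in> R ^^ l" for l
    unfolding m_def by (rule graph_dist_le[OF that])
  have neq: "f i \<noteq> f j" if "i < j" "j \<le> m" for i j
  proof
    assume "f i = f j"
    then have "(a, b) \<in> R ^^ (i + (m - j))"
      using start[of i] rest[of j] that unfolding relpow_add by auto
    from short[OF this] that show False by simp
  qed
  have "(f i, f j) \<notin> R" if "Suc i < j" "j \<le> m" for i j
  proof
    assume "(f i, f j) \<in> R"
    then have "(a, f j) \<in> R ^^ Suc i" using start[of i] that by auto
    then have "(a, b) \<in> R ^^ (Suc i + (m - j))"
      using rest[of j] that unfolding relpow_add by blast
    from short[OF this] that show False by simp
  qed
  moreover have "inj_on f {..m}"
    by (intro linorder_inj_onI) (use neq in auto)
  ultimately show thesis using f that by blast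
qed

text \<open>Integrate the pointwise bound of the sum of indicators by g times the indicator of B.
  Multiplicity counts indices, so equal sets under different indices count separately.\<close>

lemma sum_measure_le_multiplicity:
  fixes A :: "'i \<Rightarrow> 'a::euclidean_space set"
  assumes I: "finite I" and A: "\<And>i. i \<in> I \<Longrightarrow> compact (A i)" "\<And>i. i \<in> I \<Longrightarrow> A i \<subseteq> B"
    and B: "compact B" and mult: "\<And>p. card {i \<in> I. p \<in> A i} \<le> g"
  shows "(\<Sum>i\<in>I. measure lborel (A i)) \<le> real g * measure lborel B"
proof -
  have int: "integrable lborel (indicator X :: 'a \<Rightarrow> real)" if "compact X" for X
    using emeasure_compact_finite[OF that] that by (simp add: borel_compact)
  have "(\<Sum>i\<in>I. measure lborel (A i)) = (\<Sum>i\<in>I. (\<integral>p. indicator (A i) p \<partial>lborel))"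
    by simp
  also have "\<dots> = (\<integral>p. (\<Sum>i\<in>I. indicator (A i) p) \<partial>lborel)"
    using int A by (subst Bochner_Integration.integral_sum) auto
  also have "\<dots> \<le> (\<integral>p. real g * indicator B p \<partial>lborel)"
  proof (rule integral_mono)
    fix p
    have "(\<Sum>i\<in>I. indicator (A i) p :: real) = real (card {i \<in> I. p \<in> A i})"
      using I by (simp add: indicator_def sum.If_cases Collect_conj_eq)
    also have "\<dots> \<le> real g * indicator B p"
    proof (cases "p \<in> B")
      case False
      then have "{i \<in> I. p \<in> A i} = {}" using A by auto
      then show ?thesis by (simp only: card.empty) simp
    qed (use mult in simp)
    finally show "(\<Sum>i\<in>I. indicator (A i) p) \<le> real g * indicator B p" .
  qed (use int A B in auto)
  also have "\<dots> = real g * measure lborel B" by simp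
  finally show ?thesis .
qed

lemma measure_cball_conv_unit_cball:
  fixes c :: "'a::euclidean_space"
  assumes "0 \<le> s"
  shows "measure lborel (cball c s) = s ^ DIM('a) * measure lborel (cball (0::'a) 1)"
  using content_ball_conv_unit_ball[OF assms, of c] by (simp add: content_cball_conv_ball)

text \<open>
  Volume comparison. The cells of a shortest chain overlap with multiplicity at most \<open>\<gamma>\<close> when
  measured on \<open>D\<close>: for \<open>D = K\<close> because non-consecutive cells are disjoint, under the weak
  separation condition because the maps are distinct.
\<close>

lemma cell_rel_chain_bound:
  fixes g :: "'v \<Rightarrow> 'a::euclidean_space \<Rightarrow> 'a" and V :: "'v set" and lev :: "'v \<Rightarrow> nat" and K D :: "'a set"
  defines "R \<equiv> \<lambda>n c s. cell_rel V lev (\<lambda>x. g x ` K) n c s"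
  assumes r: "0 < r" and D: "compact D" "0 < measure lborel D" and K: "compact K" "K \<noteq> {}"
    and sim: "\<And>x. x \<in> V \<Longrightarrow> \<exists>t. r * r ^ lev x \<le> t \<and> t \<le> r ^ lev x \<and>
      (\<forall>p q. dist (g x p) (g x q) = t * dist p q)"
    and mult: "\<And>f m n p. inj_on f {..m} \<Longrightarrow> f ` {..m} \<subseteq> {x \<in> V. lev x = n} \<Longrightarrow>
      (\<And>i j. Suc i < j \<Longrightarrow> j \<le> m \<Longrightarrow> g (f i) ` K \<inter> g (f j) ` K = {}) \<Longrightarrow>
      card {i \<in> {..m}. p \<in> g (f i) ` D} \<le> \<gamma>"
  shows "\<exists>M. \<forall>n c a b. (a, b) \<in> (R n c (B * r ^ n))\<^sup>* \<longrightarrow> (\<exists>m\<le>M. (a, b) \<in> R n c (B * r ^ n) ^^ m)"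
proof -
  \<comment> \<open>The chain confines the images of K, while volumes are compared for images of D.
    Enlarging the radius by Q times the scale covers the latter.\<close>
  define Q where "Q = diameter (D \<union> K)"
  define W where "W = measure lborel (cball (0::'a) 1)"
  \<comment> \<open>X solves (m + 1) * (r * r ^ n) ^ d * vol D = \<gamma> * ((B + Q) * r ^ n) ^ d *
    W for m + 1, where d is the dimension; the powers of r ^ n cancel, so X does not depend on
    n.\<close>
  define X where "X = real \<gamma> * (((B + Q) / r) ^ DIM('a) * W) / measure lborel D"
  have Q: "dist p q \<le> Q" if "p \<in> D" "q \<in> K" for p q
    unfolding Q_def using D K that
    by (intro diameter_bounded_bound) (auto intro: compact_imp_bounded)
  have "\<exists>m\<le>nat \<lceil>X\<rceil>. (a, b) \<in> R n c (B * r ^ n) ^^ m"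
    if ab: "(a, b) \<in> (R n c (B * r ^ n))\<^sup>*" for n c a b
  proof -
    let ?s = "B * r ^ n"
    obtain f m where f: "f 0 = a" "f m = b" "\<And>i. i < m \<Longrightarrow> (f i, f (Suc i)) \<in> R n c ?s"
      and inj: "inj_on f {..m}" and nonadj: "\<And>i j. Suc i < j \<Longrightarrow> j \<le> m \<Longrightarrow> (f i, f j) \<notin> R n c ?s"
      using rtrancl_shortest_walk[OF ab] by blast
    have "(a, b) \<in> R n c ?s ^^ m" unfolding relpow_fun_conv using f by blast
    moreover have "m \<le> nat \<lceil>X\<rceil>"
    \<comment> \<open>A chain of length 0 says nothing about its vertex, but satisfies the bound
      trivially. Otherwise every f i is an endpoint of a step, so its cell lies in the ball.\<close>
    proof (cases "m = 0")
      case False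
      have fV: "f i \<in> V" "lev (f i) = n" and fK: "g (f i) ` K \<subseteq> cball c ?s" if "i \<le> m" for i
      proof -
        have "\<exists>y. (f i, y) \<in> R n c ?s \<or> (y, f i) \<in> R n c ?s"
          using that f(3)[of i] f(3)[of "i - 1"] False by (cases "i < m") auto
        then show "f i \<in> V" "lev (f i) = n" "g (f i) ` K \<subseteq> cball c ?s"
          by (auto simp: R_def cell_rel_def)
      qed
      \<comment> \<open>B is arbitrary, but for negative B the balls are empty and no step
        exists.\<close>
      have nn: "0 \<le> B" "0 \<le> Q"
      proof -
        obtain p where p: "p \<in> K" using K by blast
        then have "dist c (g (f 0) p) \<le> ?s" using fK[of 0] by auto
        then have "0 \<le> ?s" by (rule order_trans[OF zero_le_dist])
        then show "0 \<le> B" using zero_less_power[OF r, of n] by (simp add: zero_le_mult_iff)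
        have "D \<noteq> {}" using D by auto
        then show "0 \<le> Q" using Q p by (meson all_not_in_conv order_trans zero_le_dist)
      qed
      have D_ball: "g (f i) ` D \<subseteq> cball c ((B + Q) * r ^ n)" if i: "i \<le> m" for i
      proof
        fix y assume "y \<in> g (f i) ` D"
        then obtain p where p: "p \<in> D" "y = g (f i) p" by blast
        obtain q where q: "q \<in> K" using K by blast
        obtain t where t: "t \<le> r ^ n" "\<And>p q. dist (g (f i) p) (g (f i) q) = t * dist p q"
          using sim[OF fV(1)[OF i]] fV(2)[OF i] by auto
        have "dist c y \<le> dist c (g (f i) q) + dist (g (f i) p) (g (f i) q)"
          using dist_triangle2[of c y "g (f i) q"] p by simp
        also have "dist c (g (f i) q) \<le> ?s" using fK[OF i] q by auto
        also have "dist (g (f i) p) (g (f i) q) \<le> r ^ n * Q"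
          unfolding t(2) using t(1) Q[OF p(1) q] r by (intro mult_mono) auto
        finally show "y \<in> cball c ((B + Q) * r ^ n)" by (simp add: algebra_simps)
      qed
      have cont: "compact (g (f i) ` D)"
        and vol: "(r * r ^ n) ^ DIM('a) * measure lborel D \<le> measure lborel (g (f i) ` D)" if i: "i \<le> m" for i
      proof -
        obtain t where t: "r * r ^ n \<le> t" "\<And>p q. dist (g (f i) p) (g (f i) q) = t * dist p q"
          using sim[OF fV(1)[OF i]] fV(2)[OF i] by auto
        have "0 < r * r ^ n" using r by simp
        then have pos: "0 < t" using t(1) by linarith
        have "t-lipschitz_on D (g (f i))"
          using pos t(2) by (intro lipschitz_onI) auto
        then show "compact (g (f i) ` D)"
          using D by (intro compact_continuous_image lipschitz_on_continuous_on)
        show "(r * r ^ n) ^ DIM('a) * measure lborel D \<le> measure lborel (g (f i) ` D)"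
          using t(1) r by (simp add: measure_similitude_image[OF t(2) pos D(1)] power_mono mult_right_mono)
      qed
      have "real (Suc m) * ((r * r ^ n) ^ DIM('a) * measure lborel D)
          = (\<Sum>i\<le>m. (r * r ^ n) ^ DIM('a) * measure lborel D)"
        by simp
      also have "\<dots> \<le> (\<Sum>i\<le>m. measure lborel (g (f i) ` D))"
        using vol by (intro sum_mono) auto
      also have "\<dots> \<le> real \<gamma> * measure lborel (cball c ((B + Q) * r ^ n))"
      proof (rule sum_measure_le_multiplicity)
        show "card {i \<in> {..m}. p \<in> g (f i) ` D} \<le> \<gamma>" for p
        proof (rule mult[OF inj])
          show "f ` {..m} \<subseteq> {x \<in> V. lev x = n}" using fV by auto
          \<comment> \<open>All other conditions of \<open>cell_rel\<close> hold for the pair, so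
            being unrelated means that the cells are disjoint.\<close>
          show "g (f i) ` K \<inter> g (f j) ` K = {}" if "Suc i < j" "j \<le> m" for i j
            using nonadj[OF that] fV fK that unfolding R_def cell_rel_def by auto
        qed
      qed (use D_ball cont in auto)
      also have "\<dots> = real \<gamma> * (((B + Q) * r ^ n) ^ DIM('a) * W)"
        using nn r by (subst measure_cball_conv_unit_cball) (auto simp: W_def)
      finally have "real (Suc m) * (r ^ DIM('a) * measure lborel D) * (r ^ n) ^ DIM('a)
          \<le> real \<gamma> * ((B + Q) ^ DIM('a) * W) * (r ^ n) ^ DIM('a)"
        by (simp only: power_mult_distrib mult_ac)
      then have "real (Suc m) * (r ^ DIM('a) * measure lborel D) \<le> real \<gamma> * ((B + Q) ^ DIM('a) * W)"
        by (rule mult_right_le_imp_le) (use r in simp)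
      then have "real (Suc m) \<le> X"
        using r D by (simp add: X_def power_divide pos_le_divide_eq mult_ac)
      then show ?thesis by linarith
    qed simp
    ultimately show ?thesis by blast
  qed
  then show ?thesis by blast
qed

lemma relpow_replace_steps:
  fixes R E :: "('v \<times> 'v) set"
  assumes step: "\<And>x y. (x, y) \<in> R \<Longrightarrow> \<exists>j\<le>s. (x, y) \<in> E ^^ j" and "(a, b) \<in> R ^^ m"
  shows "\<exists>j\<le>s * m. (a, b) \<in> E ^^ j"
  using assms(2)
proof (induction m arbitrary: b)
  case (Suc m)
  then obtain c where c: "(a, c) \<in> R ^^ m" "(c, b) \<in> R" by auto
  obtain j where j: "j \<le> s * m" "(a, c) \<in> E ^^ j" using Suc.IH[OF c(1)] by blast
  obtain k where k: "k \<le> s" "(c, b) \<in> E ^^ k" using step[OF c(2)] by blast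
  have "(a, b) \<in> E ^^ (j + k)" using j k by (auto simp: relpow_add)
  then show ?case using j k by (intro exI[of _ "j + k"]) auto
qed auto

section \<open>Cells of an iterated function system\<close>

lemma word_map_append: "word_map S (u @ v) = word_map S u \<circ> word_map S v"
  by (induction u) (auto simp: word_map_def fun_eq_iff)

lemma word_ratio_append: "word_ratio \<rho> (u @ v) = word_ratio \<rho> u * word_ratio \<rho> v"
  by (simp add: word_ratio_def)

locale ifs =
  fixes N :: nat and S :: "nat \<Rightarrow> 'a::euclidean_space \<Rightarrow> 'a" and \<rho> :: "nat \<Rightarrow> real" and K :: "'a set"
  assumes similitudes: "similitude_ifs N S \<rho>" and attractor: "self_similar_set N S K"
begin

abbreviation "r \<equiv> min_ratio N \<rho>"
abbreviation "V \<equiv> vertices N S \<rho>"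
abbreviation "lev \<equiv> vertex_level N \<rho>"
abbreviation "cell x \<equiv> vertex_map S x ` K"

section \<open>Words, their ratios and levels\<close>

lemma ratio: "j \<in> {1..N} \<Longrightarrow> r \<le> \<rho> j"
  and r: "0 < r" "r < 1"
proof -
  have "r \<in> \<rho> ` {1..N}"
    unfolding min_ratio_def using similitudes by (intro Min_in) (auto simp: similitude_ifs_def)
  then show "0 < r" "r < 1" using similitudes by (auto simp: similitude_ifs_def)
  show "j \<in> {1..N} \<Longrightarrow> r \<le> \<rho> j" by (simp add: min_ratio_def)
qed

lemma word_similitude:
  assumes "w \<in> words N"
  shows "0 < word_ratio \<rho> w"
    and "dist (word_map S w p) (word_map S w q) = word_ratio \<rho> w * dist p q"
    and "word_map S w ` K \<subseteq> K"
proof -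
  have "0 < word_ratio \<rho> w \<and> dist (word_map S w p) (word_map S w q) = word_ratio \<rho> w * dist p q
      \<and> word_map S w ` K \<subseteq> K"
    using assms
  proof (induction w)
    case (Cons j w)
    then have "j \<in> {1..N}" "w \<in> words N" by (auto simp: words_def)
    moreover have "S j ` K \<subseteq> K"
      using attractor \<open>j \<in> {1..N}\<close> unfolding self_similar_set_def by blast
    ultimately show ?case
      using Cons.IH similitudes
      by (fastforce simp: word_map_def word_ratio_def similitude_ifs_def mult.assoc)
  qed (auto simp: word_map_def word_ratio_def)
  then show "0 < word_ratio \<rho> w"
    "dist (word_map S w p) (word_map S w q) = word_ratio \<rho> w * dist p q" "word_map S w ` K \<subseteq> K"
    by auto
qed

text \<open>The ratio can be read off from the map at two distinct points, here 0 and a basis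
  vector.\<close>

lemma word_ratio_eqI:
  assumes "u \<in> words N" "v \<in> words N" "word_map S u = word_map S v"
  shows "word_ratio \<rho> u = word_ratio \<rho> v"
proof -
  obtain b :: 'a where "b \<in> Basis" using nonempty_Basis by blast
  then have "dist b 0 \<noteq> 0" by auto
  then show ?thesis
    using word_similitude(2)[OF assms(1), of b 0] word_similitude(2)[OF assms(2), of b 0] assms(3)
    by simp
qed

lemma J_level_words: "w \<in> J_level N \<rho> n \<Longrightarrow> w \<in> words N"
  by (auto simp: J_level_def words_def split: if_splits)

lemma J_level_ratio:
  assumes "w \<in> J_level N \<rho> n"
  shows "word_ratio \<rho> w \<le> r ^ n" "r * r ^ n < word_ratio \<rho> w"
proof -
  have w: "w \<in> words N" using assms by (rule J_level_words)
  have "word_ratio \<rho> w \<le> r ^ n \<and> r * r ^ n < word_ratio \<rho> w"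
  proof (cases "n = 0")
    case True
    then show ?thesis using assms r by (simp add: J_level_def word_ratio_def)
  next
    case False
    then have wn: "w \<noteq> []" "word_ratio \<rho> w \<le> r ^ n" "r ^ n < word_ratio \<rho> (butlast w)"
      using assms by (auto simp: J_level_def)
    then have "last w \<in> {1..N}" using w last_in_set by (fastforce simp: words_def)
    moreover have "word_ratio \<rho> w = word_ratio \<rho> (butlast w) * \<rho> (last w)"
      using wn(1) word_ratio_append[of \<rho> "butlast w" "[last w]"] by (simp add: word_ratio_def)
    moreover have "\<rho> (last w) * r ^ n < \<rho> (last w) * word_ratio \<rho> (butlast w)"
      using wn(3) ratio[OF \<open>last w \<in> {1..N}\<close>] r by (intro mult_strict_left_mono) auto
    moreover have "r * r ^ n \<le> \<rho> (last w) * r ^ n"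
      using ratio[OF \<open>last w \<in> {1..N}\<close>] r by (intro mult_right_mono) auto
    ultimately have "r * r ^ n < word_ratio \<rho> w" by (simp add: mult.commute)
    then show ?thesis using wn by simp
  qed
  then show "word_ratio \<rho> w \<le> r ^ n" "r * r ^ n < word_ratio \<rho> w" by auto
qed

lemma J_level_unique:
  assumes "u \<in> J_level N \<rho> n" "v \<in> J_level N \<rho> m" "word_ratio \<rho> u = word_ratio \<rho> v"
  shows "n = m"
proof -
  have "r ^ Suc n < r ^ m" "r ^ Suc m < r ^ n"
    using J_level_ratio[OF assms(1)] J_level_ratio[OF assms(2)] assms(3) by auto
  then have "m < Suc n" "n < Suc m"
    using r by (meson power_strict_decreasing_iff)+
  then show ?thesis by simp
qed

lemma word_level_eq: "w \<in> J_level N \<rho> n \<Longrightarrow> word_level N \<rho> w = n"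
  unfolding word_level_def by (rule the_equality) (auto dest: J_level_unique)

lemma J_level_Suc_prefix:
  assumes w: "w \<in> J_level N \<rho> (Suc n)"
  obtains u v where "w = u @ v" "u \<in> J_level N \<rho> n" "v \<in> words N"
proof (cases "n = 0")
  case True
  show thesis
    by (rule that[of "[]" w]) (use True J_level_words[OF w] in \<open>auto simp: J_level_def\<close>)
next
  case False
  let ?P = "\<lambda>i. word_ratio \<rho> (take i w) \<le> r ^ n"
  have "word_ratio \<rho> w \<le> r ^ Suc n" using J_level_ratio[OF w] by simp
  also have "\<dots> \<le> r ^ n" using r by (intro power_decreasing) auto
  finally have ex: "?P (length w)" by simp
  define i where "i = (LEAST i. ?P i)"
  have i: "?P i" unfolding i_def using ex by (rule LeastI)
  have il: "i \<le> length w" unfolding i_def using ex by (rule Least_le)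
  have "r ^ n < 1" using r False by (simp add: power_Suc_less_one power_less_one_iff)
  then have i0: "0 < i" using i by (cases i) (auto simp: word_ratio_def)
  then have "\<not> ?P (i - 1)" unfolding i_def by (intro not_less_Least) auto
  moreover have "butlast (take i w) = take (i - 1) w"
    using il by (simp add: butlast_take)
  moreover have "set (take i w) \<subseteq> {1..N}" "set (drop i w) \<subseteq> {1..N}"
    using J_level_words[OF w] set_take_subset[of i w] set_drop_subset[of i w] by (auto simp: words_def)
  ultimately have "take i w \<in> J_level N \<rho> n" "drop i w \<in> words N"
    using False i i0 il by (auto simp: J_level_def words_def)
  then show thesis using that[of "take i w" "drop i w"] by simp
qed

lemma vertexI:
  assumes w: "w \<in> J_level N \<rho> n"
  defines "x \<equiv> word_equiv N S \<rho> `` {w}"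
  shows "x \<in> V" "w \<in> x" "lev x = n" "vertex_map S x = word_map S w"
proof -
  have wJ: "w \<in> J_all N \<rho>" using w by (auto simp: J_all_def)
  then show "x \<in> V" by (auto simp: vertices_def x_def intro: quotientI)
  show wx: "w \<in> x" using wJ by (simp add: x_def word_equiv_def)
  have "word_level N \<rho> u = n" if u: "u \<in> x" for u
  proof -
    obtain m where m: "u \<in> J_level N \<rho> m" "word_map S w = word_map S u"
      using u by (auto simp: x_def word_equiv_def J_all_def)
    then have "n = m"
      using J_level_unique[OF w m(1)] word_ratio_eqI[of w u] w J_level_words by blast
    then show ?thesis using word_level_eq[OF m(1)] by simp
  qed
  then have "word_level N \<rho> ` x = {n}" using wx by auto
  then show "lev x = n" by (simp add: vertex_level_def)
  have "word_map S ` x = {word_map S w}" using wx by (auto simp: x_def word_equiv_def)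
  then show "vertex_map S x = word_map S w" by (simp add: vertex_map_def)
qed

lemma vertexE:
  assumes "x \<in> V"
  obtains w where "w \<in> J_level N \<rho> (lev x)" "x = word_equiv N S \<rho> `` {w}" "vertex_map S x = word_map S w"
proof -
  obtain w n where w: "x = word_equiv N S \<rho> `` {w}" "w \<in> J_level N \<rho> n"
    using assms unfolding vertices_def quotient_def J_all_def by blast
  show thesis using that[of w] w vertexI[OF w(2)] by simp
qed

lemma vertex_mem: "x \<in> V \<Longrightarrow> u \<in> x \<longleftrightarrow> u \<in> J_all N \<rho> \<and> word_map S u = vertex_map S x"
proof (erule vertexE)
  fix w assume w: "w \<in> J_level N \<rho> (lev x)" "x = word_equiv N S \<rho> `` {w}" "vertex_map S x = word_map S w"
  then have "w \<in> J_all N \<rho>" unfolding J_all_def by blast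
  then show ?thesis by (subst w(2)) (auto simp: word_equiv_def w(3))
qed

lemma vertex_map_inject:
  assumes "x \<in> V" "y \<in> V" "vertex_map S x = vertex_map S y"
  shows "x = y"
  using vertex_mem[OF assms(1)] vertex_mem[OF assms(2)] assms(3) by auto

lemma vertex_similitude:
  assumes "x \<in> V"
  shows "\<exists>t. r * r ^ lev x \<le> t \<and> t \<le> r ^ lev x \<and>
    (\<forall>p q. dist (vertex_map S x p) (vertex_map S x q) = t * dist p q)"
  using assms
proof (rule vertexE)
  fix w assume w: "w \<in> J_level N \<rho> (lev x)" "vertex_map S x = word_map S w"
  then show ?thesis
    using J_level_ratio[OF w(1)] word_similitude(2)[OF J_level_words[OF w(1)]]
    by (intro exI[of _ "word_ratio \<rho> w"]) auto
qed

lemma root_vertex: "root_vertex N S \<rho> \<in> V" "x \<in> V \<Longrightarrow> lev x = 0 \<longleftrightarrow> x = root_vertex N S \<rho>"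
proof -
  have "[] \<in> J_level N \<rho> 0" by (simp add: J_level_def)
  note root = vertexI[OF this, folded root_vertex_def]
  show "root_vertex N S \<rho> \<in> V" by (rule root)
  assume "x \<in> V"
  then show "lev x = 0 \<longleftrightarrow> x = root_vertex N S \<rho>"
  proof (rule vertexE)
    fix w assume w: "w \<in> J_level N \<rho> (lev x)" "x = word_equiv N S \<rho> `` {w}"
    have "x = root_vertex N S \<rho>" if "lev x = 0"
      using w that by (simp add: J_level_def root_vertex_def)
    then show ?thesis using root(3) by auto
  qed
qed

lemma E_v_cell_subset:
  assumes "(x, y) \<in> E_v N S \<rho>"
  shows "cell y \<subseteq> cell x"
proof -
  obtain u v w where xy: "x \<in> V" "y \<in> V" and uv: "u \<in> x" "v \<in> y" "w \<in> words N" "v = u @ w"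
    using assms unfolding E_v_def by blast
  have map: "vertex_map S z = word_map S a" if "z \<in> V" "a \<in> z" for z a
    using vertex_mem that by metis
  have "cell y = word_map S u ` (word_map S w ` K)"
    using map[OF xy(2) uv(2)] uv(4) by (simp add: word_map_append image_comp)
  also have "\<dots> \<subseteq> word_map S u ` K"
    using word_similitude(3)[OF uv(3)] by (rule image_mono)
  finally show ?thesis using map[OF xy(1) uv(1)] by simp
qed

lemma parent:
  assumes y: "y \<in> V" and n: "lev y = Suc n"
  obtains x where "x \<in> V" "lev x = n" "(x, y) \<in> E_v N S \<rho>"
  using y
proof (rule vertexE)
  fix w assume w: "w \<in> J_level N \<rho> (lev y)" "y = word_equiv N S \<rho> `` {w}"
  obtain u v where uv: "w = u @ v" "u \<in> J_level N \<rho> n" "v \<in> words N"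
    using J_level_Suc_prefix w(1) n by metis
  have "w \<in> y" using vertexI(2)[OF w(1)] w(2) by simp
  then show thesis
    using vertexI[OF uv(2)] uv y n
    by (intro that[of "word_equiv N S \<rho> `` {u}"]) (auto simp: E_v_def)
qed

lemma ancestor:
  assumes "x \<in> V" "k \<le> lev x"
  shows "\<exists>a\<in>V. lev a = k \<and> cell x \<subseteq> cell a \<and> (a, x) \<in> E_v N S \<rho> ^^ (lev x - k)"
  using assms
proof (induction "lev x - k" arbitrary: x)
  case 0
  then show ?case by (intro bexI[of _ x]) auto
next
  case (Suc m)
  then obtain n where n: "lev x = Suc n" by (cases "lev x") auto
  then obtain y where y: "y \<in> V" "lev y = n" "(y, x) \<in> E_v N S \<rho>"
    using parent Suc.prems by blast
  then have "m = lev y - k" "k \<le> lev y" using Suc.hyps(2) n by auto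
  then obtain a where a: "a \<in> V" "lev a = k" "cell y \<subseteq> cell a" "(a, y) \<in> E_v N S \<rho> ^^ (lev y - k)"
    using Suc.hyps(1)[of y] y(1) by blast
  have "lev x - k = Suc (lev y - k)" using Suc.hyps(2) y n by simp
  moreover have "cell x \<subseteq> cell a" using E_v_cell_subset[OF y(3)] a(3) by (rule order_trans)
  ultimately show ?case using a y by (intro bexI[of _ a]) auto
qed

lemma cell_graph:
  assumes sym: "sym E" and vert: "E_v N S \<rho> \<subseteq> E"
    and E: "\<And>x y. (x, y) \<in> E \<Longrightarrow> x \<in> V \<and> y \<in> V \<and> lev y \<le> lev x + 1 \<and> cell x \<inter> cell y \<noteq> {}"
  shows "cell_graph V E (root_vertex N S \<rho>) lev cell (diameter K) r"
proof
  show "\<exists>a\<in>V. lev a = k \<and> cell x \<subseteq> cell a \<and> (x, a) \<in> E ^^ (lev x - k)"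
    if x: "x \<in> V" "k \<le> lev x" for x k
  proof -
    obtain a where a: "a \<in> V" "lev a = k" "cell x \<subseteq> cell a" "(a, x) \<in> E_v N S \<rho> ^^ (lev x - k)"
      using ancestor[OF x] by blast
    have "(a, x) \<in> E ^^ (lev x - k)"
      using a(4) vert unfolding relpow_fun_conv by blast
    then show ?thesis using a symD[OF sym_relpow[OF sym]] by blast
  qed
  show "dist p q \<le> diameter K * r ^ lev x"
    if x: "x \<in> V" and pq: "p \<in> cell x" "q \<in> cell x" for x p q
  proof -
    obtain t where t: "t \<le> r ^ lev x" "\<And>p q. dist (vertex_map S x p) (vertex_map S x q) = t * dist p q"
      using vertex_similitude[OF x] by blast
    obtain p' q' where *: "p' \<in> K" "q' \<in> K" "p = vertex_map S x p'" "q = vertex_map S x q'"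
      using pq by blast
    have "bounded K" using attractor by (simp add: self_similar_set_def compact_imp_bounded)
    then have "dist p' q' \<le> diameter K" using * by (intro diameter_bounded_bound)
    then have "t * dist p' q' \<le> r ^ lev x * diameter K" using t r by (intro mult_mono) auto
    then show ?thesis using * t by (simp add: mult.commute)
  qed
  show "cell x \<noteq> {}" for x using attractor by (simp add: self_similar_set_def)
  show "(lev x = 0) = (x = root_vertex N S \<rho>)" if "x \<in> V" for x
    using root_vertex(2)[OF that] .
  show "x \<in> V \<and> y \<in> V" "lev y \<le> lev x + 1" "cell x \<inter> cell y \<noteq> {}" if "(x, y) \<in> E" for x y
    using E[OF that] by auto
qed (fact r root_vertex(1) sym)+

lemma chain_bound:
  assumes "0 < emeasure lborel K \<or> weak_separation N S \<rho>"
  shows "\<exists>M. \<forall>n c a b. (a, b) \<in> (cell_rel V lev cell n c (B * r ^ n))\<^sup>* \<longrightarrow>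
    (\<exists>m\<le>M. (a, b) \<in> cell_rel V lev cell n c (B * r ^ n) ^^ m)"
proof -
  have K: "compact K" "K \<noteq> {}" using attractor by (auto simp: self_similar_set_def)
  from assms show ?thesis
  proof
    assume pos: "0 < emeasure lborel K"
    show ?thesis
    proof (rule cell_rel_chain_bound[where D = K and \<gamma> = 2])
      show "0 < measure lborel K"
        using pos emeasure_compact_finite[OF K(1)]
        by (simp add: measure_def enn2real_positive_iff)
      fix f :: "nat \<Rightarrow> nat list set" and m p
      assume dis: "\<And>i j. Suc i < j \<Longrightarrow> j \<le> m \<Longrightarrow> cell (f i) \<inter> cell (f j) = {}"
      let ?A = "{i \<in> {..m}. p \<in> cell (f i)}"
      have "?A \<subseteq> {Min ?A, Suc (Min ?A)}"
      proof
        fix j assume j: "j \<in> ?A"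
        define k where "k = Min ?A"
        have "finite ?A" by simp
        then have k: "k \<in> ?A" "k \<le> j" unfolding k_def using Min_in Min_le j by blast+
        then have "p \<in> cell (f k) \<inter> cell (f j)" "j \<le> m" using j by simp_all
        then have "\<not> Suc k < j" using dis[of k j] by (metis emptyE)
        then have "j = k \<or> j = Suc k" using k(2) by linarith
        then show "j \<in> {Min ?A, Suc (Min ?A)}" unfolding k_def by blast
      qed
      then have "card ?A \<le> card {Min ?A, Suc (Min ?A)}" by (rule card_mono[rotated]) simp
      then show "card ?A \<le> 2" by simp
    qed (use r K vertex_similitude in auto)
  next
    assume "weak_separation N S \<rho>"
    then obtain \<gamma> :: real and D where D: "compact D" "interior D \<noteq> {}"
      and bound: "\<forall>n\<ge>1. \<forall>p. finite {T \<in> level_maps N S \<rho> n. p \<in> T ` D} \<and>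
        real (card {T \<in> level_maps N S \<rho> n. p \<in> T ` D}) \<le> \<gamma>"
      unfolding weak_separation_def by (elim exE conjE) (rule that)
    have \<gamma>: "finite {T \<in> level_maps N S \<rho> n. p \<in> T ` D}"
      "real (card {T \<in> level_maps N S \<rho> n. p \<in> T ` D}) \<le> \<gamma>" if "n \<ge> 1" for n p
      using bound[rule_format, OF that] by auto
    show ?thesis
    proof (rule cell_rel_chain_bound[where D = D and \<gamma> = "max 1 (nat \<lfloor>\<gamma>\<rfloor>)"])
      obtain z e where e: "0 < e" "cball z e \<subseteq> D"
        using D(2) by (auto simp: mem_interior_cball)
      have "0 < measure lborel (cball z e)" using e(1) by (rule content_cball_pos)
      also have "\<dots> \<le> measure lborel D"
        using D e by (intro measure_mono_fmeasurable) (auto simp: fmeasurable_compact borel_compact)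
      finally show "0 < measure lborel D" .
      fix f :: "nat \<Rightarrow> nat list set" and m n p
      assume inj: "inj_on f {..m}" and f: "f ` {..m} \<subseteq> {x \<in> V. lev x = n}"
      have fV: "f i \<in> V \<and> lev (f i) = n" if "i \<in> {..m}" for i
        using subsetD[OF f imageI[OF that]] by simp
      let ?A = "{i \<in> {..m}. p \<in> vertex_map S (f i) ` D}"
      show "card ?A \<le> max 1 (nat \<lfloor>\<gamma>\<rfloor>)"
      proof (cases "n = 0")
        case True
        have "?A \<subseteq> {0}"
        proof
          fix i assume "i \<in> ?A"
          then have i: "i \<in> {..m}" by simp
          have "f j = root_vertex N S \<rho>" if "j \<in> {..m}" for j
            using fV[OF that] root_vertex(2)[of "f j"] True by simp
          then have "f i = f 0" using i by simp
          then show "i \<in> {0}" using inj i by (simp add: inj_on_eq_iff)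
        qed
        then have "card ?A \<le> card {0::nat}" by (intro card_mono) auto
        then show ?thesis by simp
      next
        case False
        let ?L = "{T \<in> level_maps N S \<rho> n. p \<in> T ` D}"
        have "inj_on (\<lambda>i. vertex_map S (f i)) ?A"
        proof (rule inj_onI)
          fix i j assume ij: "i \<in> ?A" "j \<in> ?A" "vertex_map S (f i) = vertex_map S (f j)"
          then have le: "i \<in> {..m}" "j \<in> {..m}" by simp_all
          then have "f i \<in> V" "f j \<in> V" by (simp_all only: fV)
          then have "f i = f j" using ij(3) by (rule vertex_map_inject)
          then show "i = j" using inj le by (simp add: inj_on_eq_iff)
        qed
        moreover have "(\<lambda>i. vertex_map S (f i)) ` ?A \<subseteq> ?L"
        proof (rule image_subsetI)
          fix i assume i: "i \<in> ?A"
          then have "f i \<in> V" "lev (f i) = n" using fV[of i] by simp_all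
          then obtain w where "w \<in> J_level N \<rho> n" "vertex_map S (f i) = word_map S w"
            by (metis vertexE)
          then have "vertex_map S (f i) \<in> level_maps N S \<rho> n"
            by (simp add: level_maps_def)
          then show "vertex_map S (f i) \<in> ?L" using i by simp
        qed
        ultimately have "card ?A \<le> card ?L" using \<gamma>(1)[of n p] False by (intro card_inj_on_le) auto
        also have "card ?L \<le> nat \<lfloor>\<gamma>\<rfloor>" using \<gamma>(2)[of n p] False by (simp add: le_nat_floor)
        finally show ?thesis by simp
      qed
    qed (use r K D vertex_similitude in auto)
  qed
qed

lemma hyperbolic_graphI:
  assumes meas: "0 < emeasure lborel K \<or> weak_separation N S \<rho>"
    and E: "sym E" "E_v N S \<rho> \<subseteq> E"
      "\<And>x y. (x, y) \<in> E \<Longrightarrow> x \<in> V \<and> y \<in> V \<and> lev y \<le> lev x + 1 \<and> cell x \<inter> cell y \<noteq> {}"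
    and steps: "\<And>x y. x \<in> V \<Longrightarrow> y \<in> V \<Longrightarrow> lev x = lev y \<Longrightarrow> cell x \<inter> cell y \<noteq> {} \<Longrightarrow>
      \<exists>j\<le>2. (x, y) \<in> E ^^ j"
  shows "hyperbolic_graph V E (root_vertex N S \<rho>)"
proof -
  interpret cell_graph V E "root_vertex N S \<rho>" lev cell "diameter K" r
    by (rule cell_graph[OF E])
  show ?thesis
  proof (rule hyperbolic)
    fix B
    obtain M where M: "\<And>n c a b. (a, b) \<in> (cell_rel V lev cell n c (B * r ^ n))\<^sup>* \<Longrightarrow>
        (\<exists>m\<le>M. (a, b) \<in> cell_rel V lev cell n c (B * r ^ n) ^^ m)"
      using chain_bound[OF meas] by blast
    show "\<exists>M. \<forall>n c a b. (a, b) \<in> (cell_rel V lev cell n c (B * r ^ n))\<^sup>* \<longrightarrow> (\<exists>m\<le>M. (a, b) \<in> E ^^ m)"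
    proof (rule exI[of _ "2 * M"], intro allI impI)
      fix n c a b
      assume "(a, b) \<in> (cell_rel V lev cell n c (B * r ^ n))\<^sup>*"
      then obtain m where m: "m \<le> M" "(a, b) \<in> cell_rel V lev cell n c (B * r ^ n) ^^ m"
        using M by blast
      have "\<exists>j\<le>2 * m. (a, b) \<in> E ^^ j"
        using relpow_replace_steps[OF _ m(2), of 2 E] steps by (auto simp: cell_rel_def)
      then show "\<exists>j\<le>2 * M. (a, b) \<in> E ^^ j" using m(1) by (meson mult_le_mono2 order_trans)
    qed
  qed
qed

lemma E_v_edge:
  assumes "(x, y) \<in> E_v N S \<rho>"
  shows "x \<in> V" "y \<in> V" "lev y = lev x + 1" "cell x \<inter> cell y \<noteq> {}"
proof -
  have "cell y \<noteq> {}" using attractor by (simp add: self_similar_set_def)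
  then show "cell x \<inter> cell y \<noteq> {}" using E_v_cell_subset[OF assms] by blast
qed (use assms in \<open>auto simp: E_v_def\<close>)

lemma hyperbolic_E_aug:
  assumes "0 < emeasure lborel K \<or> weak_separation N S \<rho>"
  shows "hyperbolic_graph V (E_aug N S \<rho> K) (root_vertex N S \<rho>)"
proof (rule hyperbolic_graphI[OF assms])
  show "sym (E_aug N S \<rho> K)" "E_v N S \<rho> \<subseteq> E_aug N S \<rho> K"
    by (auto simp: E_aug_def undirected_def sym_def)
  show "x \<in> V \<and> y \<in> V \<and> lev y \<le> lev x + 1 \<and> cell x \<inter> cell y \<noteq> {}"
    if "(x, y) \<in> E_aug N S \<rho> K" for x y
    using that E_v_edge[of x y] E_v_edge[of y x]
    by (auto simp: E_aug_def undirected_def E_h_def Int_commute)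
  show "\<exists>j\<le>2. (x, y) \<in> E_aug N S \<rho> K ^^ j"
    if "x \<in> V" "y \<in> V" "lev x = lev y" "cell x \<inter> cell y \<noteq> {}" for x y
  proof (cases "x = y")
    case True
    then show ?thesis by (intro exI[of _ 0]) auto
  next
    case False
    then have "(x, y) \<in> E_aug N S \<rho> K"
      using that by (auto simp: E_aug_def undirected_def E_h_def)
    then show ?thesis by (intro exI[of _ 1]) auto
  qed
qed

lemma hyperbolic_E_diamond:
  assumes "0 < emeasure lborel K \<or> weak_separation N S \<rho>"
  shows "hyperbolic_graph V (E_diamond N S \<rho> K) (root_vertex N S \<rho>)"
proof (rule hyperbolic_graphI[OF assms])
  let ?E = "E_diamond N S \<rho> K"
  show sym: "sym ?E" and vert: "E_v N S \<rho> \<subseteq> ?E"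
    by (auto simp: E_diamond_def undirected_def sym_def)
  show "x \<in> V \<and> y \<in> V \<and> lev y \<le> lev x + 1 \<and> cell x \<inter> cell y \<noteq> {}"
    if "(x, y) \<in> ?E" for x y
    using that E_v_edge[of x y] E_v_edge[of y x]
    by (auto simp: E_diamond_def undirected_def E_v_plus_def Int_commute)
  show "\<exists>j\<le>2. (x, y) \<in> ?E ^^ j"
    if xy: "x \<in> V" "y \<in> V" "lev x = lev y" "cell x \<inter> cell y \<noteq> {}" for x y
  proof (cases "lev y")
    case 0
    then have "x = y" using xy(1-3) root_vertex(2)[of x] root_vertex(2)[of y] by metis
    then show ?thesis by (intro exI[of _ 0]) auto
  next
    case (Suc n)
    then obtain z where z: "z \<in> V" "lev z = n" "(z, y) \<in> E_v N S \<rho>"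
      using parent xy(2) by blast
    have "cell z \<inter> cell x \<noteq> {}" using E_v_cell_subset[OF z(3)] xy(4) by blast
    then have "(z, x) \<in> ?E"
      using z xy Suc by (auto simp: E_diamond_def undirected_def E_v_plus_def)
    then have "(x, z) \<in> ?E" "(z, y) \<in> ?E" using z vert sym by (auto dest: symD)
    then have "(x, y) \<in> ?E ^^ 2" by (auto simp: numeral_2_eq_2)
    then show ?thesis by blast
  qed
qed

end

theorem theorem1p1:
  fixes N :: nat
    and S :: "nat \<Rightarrow> 'a::euclidean_space \<Rightarrow> 'a"
    and \<rho> :: "nat \<Rightarrow> real"
    and K :: "'a set"
  assumes "similitude_ifs N S \<rho>"
    and "self_similar_set N S K"
    and "emeasure lborel K > 0 \<or> weak_separation N S \<rho>"
  shows "hyperbolic_graph (vertices N S \<rho>) (E_aug N S \<rho> K) (root_vertex N S \<rho>) \<and>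
         hyperbolic_graph (vertices N S \<rho>) (E_diamond N S \<rho> K) (root_vertex N S \<rho>)"
proof -
  interpret ifs N S \<rho> K using assms by unfold_locales
  show ?thesis using hyperbolic_E_aug hyperbolic_E_diamond assms(3) by simp
qed

end
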